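(* Suppose that the parameter sequences satisfy $\rho_k,\sigma_k,\delta_k>0$, $\rho_k\to\infty$, $\sigma_k\to0$, $\delta_k\to0$ and $\limsup_{k\to\infty}\sigma_k/\delta_k<\infty$, and that $\phi$ is lower semicontinuous on $X$. For each $k$, let $x_k\in\arg\min_{x\in X}\phi_k(x)$. Then every accumulation point $\bar x$ of $\{x_k\}$ is a global solution of the pessimistic bilevel problem $\min_{x\in X}\phi(x)$; that is, $\bar x\in\arg\min_{x\in X}\phi(x)$.
   Context: $X\subseteq\mathbb R^n$ and $Y\subseteq\mathbb R^m$ are nonempty, closed and convex, and $F,f:\mathbb R^n\times\mathbb R^m\to\mathbb R$. For $x\in X$ let $\mathcal S(x):=\arg\min_{y\in Y}f(x,y)$. Standing assumptions. (A1) $F$ is continuously differentiable and $\nabla F$ is Lipschitz continuous on $X\times Y$. For every $x\in X$, $F(x,\cdot)$ is concave on $Y$ and $-F(x,\cdot)$ is coercive on $Y$, i.e. $\lim_{\|y\|\to\infty,\,y\in Y}F(x,y)=-\infty$. (A2) $f$ is continuously differentiable and $\nabla f$ is Lipschitz continuous on $X\times Y$. For every $x\in X$, $f(x,\cdot)$ is convex on $Y$ and $\mathcal S(x)\neq\emptyset$. For every bounded set $D_x\subseteq X$ there is a bounded set $D_y\subseteq Y$ with $\mathcal S(x)\cap D_y\neq\emptyset$ for every $x\in D_x$. The pessimistic value function is $\phi(x):=\max\{F(x,y):y\in\mathcal S(x)\}$ for $x\in X$ (the maximum is attained). For $\rho,\sigma,\delta>0$ define $$\psi_{\rho,\sigma,\delta}(x,y,z):=F(x,y)-\rho\bigl(f(x,y)-f(x,z)\bigr)+\frac{\sigma}{2}\|z\|^2-\sigma\langle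 y,z\rangle-\frac{\delta}{2}\|y\|^2,$$ $$\phi_{\rho,\sigma,\delta}(x):=\min_{z\in Y}\max_{y\in Y}\psi_{\rho,\sigma,\delta}(x,y,z)=\max_{y\in Y}\min_{z\in Y}\psi_{\rho,\sigma,\delta}(x,y,z),\qquad x\in X,$$ which is well defined and finite. Given parameter sequences $(\rho_k,\sigma_k,\delta_k)$, write $\phi_k:=\phi_{\rho_k,\sigma_k,\delta_k}$. *)

theory Defs
  imports "HOL-Analysis.Analysis"
begin

definition argmin_on :: "('a \<Rightarrow> real) \<Rightarrow> 'a set \<Rightarrow> 'a set" where
  "argmin_on g A = {x. is_arg_min g (\<lambda>u. u \<in> A) x}"

text \<open>
  \<open>max_on g A\<close> and \<open>min_on g A\<close> are attained extrema (\<open>Greatest\<close> and \<open>Least\<close>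
  rather than \<open>Sup\<close> and \<open>Inf\<close>). They are unspecified if the extremum is not attained.
\<close>

definition max_on :: "('a \<Rightarrow> real) \<Rightarrow> 'a set \<Rightarrow> real" where
  "max_on g A = (GREATEST v. v \<in> g ` A)"

definition min_on :: "('a \<Rightarrow> real) \<Rightarrow> 'a set \<Rightarrow> real" where
  "min_on g A = (LEAST v. v \<in> g ` A)"

definition lsc_on :: "'a::topological_space set \<Rightarrow> ('a \<Rightarrow> real) \<Rightarrow> bool" where
  "lsc_on A g \<longleftrightarrow> (\<forall>x\<in>A. \<forall>c. c < g x \<longrightarrow> (\<forall>\<^sub>F u in at x within A. c < g u))"

text \<open>
  Continuously differentiable on the whole space, with gradient Lipschitz on \<open>A\<close>.
  The gradient \<open>G\<close> is unique.
\<close>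

definition C1_lipschitz_gradient_on :: "'a::real_inner set \<Rightarrow> ('a \<Rightarrow> real) \<Rightarrow> bool" where
  "C1_lipschitz_gradient_on A g \<longleftrightarrow>
    (\<exists>G. (\<forall>p. GDERIV g p :> G p) \<and> continuous_on UNIV G \<and> (\<exists>L. L-lipschitz_on A G))"

definition tends_to_minus_infinity_on :: "'a::real_normed_vector set \<Rightarrow> ('a \<Rightarrow> real) \<Rightarrow> bool" where
  "tends_to_minus_infinity_on A g \<longleftrightarrow> filterlim g at_bot (inf at_infinity (principal A))"

definition lower_solutions ::
    "'b set \<Rightarrow> ('a \<times> 'b \<Rightarrow> real) \<Rightarrow> 'a \<Rightarrow> 'b set" where
  "lower_solutions Y f x = argmin_on (\<lambda>y. f (x, y)) Y"

definition upper_level_assumptions ::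
    "'a::real_inner set \<Rightarrow> 'b::real_inner set \<Rightarrow> ('a \<times> 'b \<Rightarrow> real) \<Rightarrow> bool" where
  "upper_level_assumptions X Y F \<longleftrightarrow>
    C1_lipschitz_gradient_on (X \<times> Y) F \<and>
    (\<forall>x\<in>X. concave_on Y (\<lambda>y. F (x, y)) \<and> tends_to_minus_infinity_on Y (\<lambda>y. F (x, y)))"

definition lower_level_assumptions ::
    "'a::real_inner set \<Rightarrow> 'b::real_inner set \<Rightarrow> ('a \<times> 'b \<Rightarrow> real) \<Rightarrow> bool" where
  "lower_level_assumptions X Y f \<longleftrightarrow>
    C1_lipschitz_gradient_on (X \<times> Y) f \<and>
    (\<forall>x\<in>X. convex_on Y (\<lambda>y. f (x, y)) \<and> lower_solutions Y f x \<noteq> {}) \<and>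
    (\<forall>Dx. bounded Dx \<and> Dx \<subseteq> X \<longrightarrow>
      (\<exists>Dy. bounded Dy \<and> Dy \<subseteq> Y \<and> (\<forall>x\<in>Dx. lower_solutions Y f x \<inter> Dy \<noteq> {})))"

definition pessimistic_value ::
    "'b set \<Rightarrow> ('a \<times> 'b \<Rightarrow> real) \<Rightarrow> ('a \<times> 'b \<Rightarrow> real) \<Rightarrow> 'a \<Rightarrow> real" where
  "pessimistic_value Y F f x = max_on (\<lambda>y. F (x, y)) (lower_solutions Y f x)"

definition smoothed_objective ::
    "('a \<times> 'b::real_inner \<Rightarrow> real) \<Rightarrow> ('a \<times> 'b \<Rightarrow> real) \<Rightarrow> real \<Rightarrow> real \<Rightarrow> real
      \<Rightarrow> 'a \<Rightarrow> 'b \<Rightarrow> 'b \<Rightarrow> real" where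
  "smoothed_objective F f \<rho> \<sigma> \<delta> x y z =
    F (x, y) - \<rho> * (f (x, y) - f (x, z)) + \<sigma> / 2 * (norm z)\<^sup>2 - \<sigma> * inner y z - \<delta> / 2 * (norm y)\<^sup>2"

definition smoothed_value ::
    "'b::real_inner set \<Rightarrow> ('a \<times> 'b \<Rightarrow> real) \<Rightarrow> ('a \<times> 'b \<Rightarrow> real) \<Rightarrow> real \<Rightarrow> real \<Rightarrow> real
      \<Rightarrow> 'a \<Rightarrow> real" where
  "smoothed_value Y F f \<rho> \<sigma> \<delta> x =
    min_on (\<lambda>z. max_on (\<lambda>y. smoothed_objective F f \<rho> \<sigma> \<delta> x y z) Y) Y"

end

theory Submission
  imports Defs
begin

text \<open>
  Let \<open>\<phi>\<close> be the pessimistic value and \<open>\<phi>\<^sub>k\<close> the smoothed one. Choosing \<open>z\<close> in the solution set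
  \<open>S x\<close> bounds \<open>\<phi>\<^sub>k x\<close> above by the maximum of \<open>F - \<rho>\<^sub>k (f - min f)\<close> plus terms of order
  \<open>\<sigma>\<^sub>k + \<sigma>\<^sub>k\<^sup>2 / \<delta>\<^sub>k\<close>; since \<open>f - min f\<close> is bounded away from zero on the compact set
  \<open>{F \<ge> \<phi> x + e}\<close>, this gives \<open>limsup \<phi>\<^sub>k x \<le> \<phi> x\<close>. Choosing \<open>y = y\<^sub>k\<close> as a maximiser of \<open>F\<close>
  on \<open>S x\<^sub>k\<close> gives \<open>\<phi>\<^sub>k x\<^sub>k \<ge> \<phi> x\<^sub>k - (\<sigma>\<^sub>k + \<delta>\<^sub>k) / 2 * |y\<^sub>k|\<^sup>2\<close>, and \<open>y\<^sub>k\<close> stays bounded because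
  concavity makes the coercivity of \<open>F\<close> locally uniform in \<open>x\<close>. Lower semicontinuity of \<open>\<phi>\<close>
  then yields \<open>\<phi> xbar \<le> liminf \<phi>\<^sub>k x\<^sub>k \<le> limsup \<phi>\<^sub>k x \<le> \<phi> x\<close> for every \<open>x\<close>.
\<close>

section \<open>Attained extrema and compactness of level sets\<close>

lemma argmin_on_iff: "x \<in> argmin_on g A \<longleftrightarrow> x \<in> A \<and> (\<forall>y\<in>A. g x \<le> g y)"
  by (auto simp: argmin_on_def is_arg_min_def not_less)

lemma max_on_eqI:
  assumes "a \<in> A" "\<And>b. b \<in> A \<Longrightarrow> g b \<le> g a"
  shows "max_on g A = g a"
  unfolding max_on_def using assms by (intro Greatest_equality) auto

lemma min_on_eqI:
  assumes "a \<in> A" "\<And>b. b \<in> A \<Longrightarrow> g a \<le> g b"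
  shows "min_on g A = g a"
  unfolding min_on_def using assms by (intro Least_equality) auto

text \<open>Sublevel sets are nested, so finitely many of them meet in the smallest; the finite
  intersection property then gives a point common to all of them. The lemma is phrased through level
  sets because the inner maximum in \<open>z\<close> is controlled only through its sublevel
  sets.\<close>

lemma attains_min_of_compact_sublevels:
  fixes g :: "'a::t2_space \<Rightarrow> real"
  assumes "A \<noteq> {}" and compact_sub: "\<And>c. compact {a\<in>A. g a \<le> c}"
  shows "\<exists>a\<in>A. \<forall>b\<in>A. g a \<le> g b"
proof -
  obtain a0 where a0: "a0 \<in> A" using assms by auto
  let ?sub = "\<lambda>b. {a\<in>A. g a \<le> g b}"
  have "?sub a0 \<inter> \<Inter>(?sub ` A) \<noteq> {}"
  proof (rule compact_imp_fip)
    show "compact (?sub a0)" by (rule compact_sub)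
    show "closed T" if "T \<in> ?sub ` A" for T
      using that compact_sub compact_imp_closed by blast
    show "?sub a0 \<inter> \<Inter>F' \<noteq> {}" if fin: "finite F'" and sub: "F' \<subseteq> ?sub ` A" for F'
    proof -
      obtain B where B: "B \<subseteq> A" "finite B" "F' = ?sub ` B"
        using fin sub by (meson finite_subset_image)
      \<comment> \<open>Inserting \<open>a0\<close> covers the case of empty \<open>B\<close> and
        also places \<open>m\<close> in \<open>?sub a0\<close>.\<close>
      have fin': "finite (insert a0 B)" "insert a0 B \<noteq> {}" using B(2) by auto
      obtain m where "m \<in> insert a0 B" "\<And>b. b \<in> insert a0 B \<Longrightarrow> g m \<le> g b"
        using arg_min_if_finite(1)[OF fin'] arg_min_least[OF fin'] by blast
      then have "m \<in> ?sub a0 \<inter> \<Inter>F'" using B a0 by auto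
      then show ?thesis by blast
    qed
  qed
  then show ?thesis by blast
qed

lemma attains_max_of_compact_superlevels:
  fixes g :: "'a::t2_space \<Rightarrow> real"
  assumes "A \<noteq> {}" and "\<And>c. compact {a\<in>A. c \<le> g a}"
  shows "\<exists>a\<in>A. \<forall>b\<in>A. g b \<le> g a"
proof -
  have "compact {a\<in>A. - g a \<le> c}" for c
    using assms(2)[of "- c"] by (simp add: minus_le_iff)
  from attains_min_of_compact_sublevels[OF assms(1) this] show ?thesis by simp
qed

lemma bounded_superlevel:
  assumes "tends_to_minus_infinity_on A g"
  shows "bounded {a\<in>A. c \<le> g a}"
proof -
  have "\<forall>\<^sub>F a in inf at_infinity (principal A). g a < c"
    using assms unfolding tends_to_minus_infinity_on_def filterlim_at_bot_dense by blast
  then obtain B where "\<And>a. B \<le> norm a \<Longrightarrow> a \<in> A \<Longrightarrow> g a < c"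
    unfolding eventually_inf_principal eventually_at_infinity by blast
  then show ?thesis
    by (intro boundedI[of _ B]) (metis (mono_tags, lifting) linorder_not_le mem_Collect_eq nle_le)
qed

text \<open>Continuity gives closedness, the dominating \<open>h\<close> gives boundedness. It is
  used for the smoothed objective in \<open>y\<close>, which lies below \<open>F\<close> plus a
  constant.\<close>

lemma compact_superlevel_if_dominated:
  fixes g h :: "'a::heine_borel \<Rightarrow> real"
  assumes "closed A" "continuous_on A g" "bounded {a\<in>A. c \<le> h a}"
    and "\<And>a. a \<in> A \<Longrightarrow> g a \<le> h a"
  shows "compact {a\<in>A. c \<le> g a}"
proof -
  have "closed {a\<in>A. c \<le> g a}"
    by (rule continuous_on_closed_Collect_le[OF continuous_on_const assms(2,1)])
  moreover have "bounded {a\<in>A. c \<le> g a}"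
    by (rule bounded_subset[OF assms(3)]) (use assms(4) in force)
  ultimately show ?thesis by (simp add: compact_eq_bounded_closed)
qed

lemma compact_superlevel:
  fixes g :: "'a::{heine_borel, real_normed_vector} \<Rightarrow> real"
  assumes "closed A" "continuous_on A g" "tends_to_minus_infinity_on A g"
  shows "compact {a\<in>A. c \<le> g a}"
  using compact_superlevel_if_dominated[OF assms(1,2) bounded_superlevel[OF assms(3)]] by blast

section \<open>Lower-level solution sets and the pessimistic value\<close>

lemma closed_lower_solutions:
  assumes "closed Y" "continuous_on Y (\<lambda>y. f (x, y))"
  shows "closed (lower_solutions Y f x)"
proof (cases "lower_solutions Y f x = {}")
  case False
  then obtain s where "s \<in> lower_solutions Y f x" by auto
  then have "lower_solutions Y f x = {y\<in>Y. f (x, y) \<le> f (x, s)}"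
    by (force simp: lower_solutions_def argmin_on_iff intro: order_trans)
  then show ?thesis
    using assms by (simp add: continuous_on_closed_Collect_le)
qed simp

text \<open>\<open>max_on\<close> carries information only when the maximum is attained. Here it is:
  the solution set is closed, and coercivity of \<open>F\<close> makes its superlevel sets there
  compact.\<close>

lemma pessimistic_value_attained:
  fixes F f :: "'a \<times> 'b::euclidean_space \<Rightarrow> real"
  assumes "closed Y" "continuous_on Y (\<lambda>y. F (x, y))" "continuous_on Y (\<lambda>y. f (x, y))"
    and "tends_to_minus_infinity_on Y (\<lambda>y. F (x, y))" "lower_solutions Y f x \<noteq> {}"
  obtains y where "y \<in> lower_solutions Y f x" "pessimistic_value Y F f x = F (x, y)"
    "\<And>s. s \<in> lower_solutions Y f x \<Longrightarrow> F (x, s) \<le> F (x, y)"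
proof -
  let ?S = "lower_solutions Y f x"
  have "compact {y\<in>?S. c \<le> F (x, y)}" for c
  proof -
    have "{y\<in>?S. c \<le> F (x, y)} = ?S \<inter> {y\<in>Y. c \<le> F (x, y)}"
      by (auto simp: lower_solutions_def argmin_on_iff)
    then show ?thesis
      using closed_lower_solutions[of Y f x] compact_superlevel[of Y] assms
      by (simp add: closed_Int_compact)
  qed
  from attains_max_of_compact_superlevels[OF assms(5) this]
  obtain y where "y \<in> ?S" "\<And>s. s \<in> ?S \<Longrightarrow> F (x, s) \<le> F (x, y)" by blast
  then show ?thesis
    using that max_on_eqI[of y ?S "\<lambda>y. F (x, y)"] by (simp add: pessimistic_value_def)
qed

text \<open>Completing the square: the gap between the two sides is the squared norm of
  \<open>\<delta> *\<^sub>R y + \<sigma> *\<^sub>R z\<close> divided by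
  \<open>2 * \<delta>\<close>.\<close>

lemma neg_inner_le:
  fixes y z :: "'b::real_inner"
  assumes "\<delta> > 0"
  shows "- \<sigma> * inner y z - \<delta> / 2 * (norm y)\<^sup>2 \<le> \<sigma>\<^sup>2 / (2 * \<delta>) * (norm z)\<^sup>2"
proof -
  have "0 \<le> (norm (\<delta> *\<^sub>R y + \<sigma> *\<^sub>R z))\<^sup>2 / (2 * \<delta>)"
    using assms by simp
  also have "\<dots> = \<delta> / 2 * (norm y)\<^sup>2 + \<sigma> * inner y z + \<sigma>\<^sup>2 / (2 * \<delta>) * (norm z)\<^sup>2"
    using assms unfolding power2_norm_eq_inner
    by (simp add: inner_simps inner_commute field_simps power2_eq_square)
  finally show ?thesis by linarith
qed

section \<open>The smoothed value at one point for fixed parameters\<close>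

context
  fixes Y :: "'b::euclidean_space set" and F f :: "'a \<times> 'b \<Rightarrow> real"
    and \<rho> \<sigma> \<delta> :: real and x :: 'a
  assumes Y: "closed Y" "Y \<noteq> {}"
    and contF: "continuous_on Y (\<lambda>y. F (x, y))"
    and contf: "continuous_on Y (\<lambda>y. f (x, y))"
    and coercive: "tends_to_minus_infinity_on Y (\<lambda>y. F (x, y))"
    and solvable: "lower_solutions Y f x \<noteq> {}"
    and pos: "\<rho> > 0" "\<sigma> > 0" "\<delta> > 0"
begin

text \<open>The regularisation is bounded independently of \<open>y\<close>; this is where the
  quotient of \<sigma> squared by \<delta> enters.\<close>

lemma smoothed_objective_le:
  "smoothed_objective F f \<rho> \<sigma> \<delta> x y z \<le>
  F (x, y) - \<rho> * (f (x, y) - f (x, z)) + (\<sigma> / 2 + \<sigma>\<^sup>2 / (2 * \<delta>)) * (norm z)\<^sup>2"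
  using neg_inner_le[OF pos(3), of \<sigma> y z] by (simp add: smoothed_objective_def algebra_simps)

text \<open>For a lower-level solution \<open>s\<close> the penalty term has a favourable sign. The
  square in \<open>z - s\<close> is kept because it supplies coercivity in \<open>z\<close>.\<close>

lemma smoothed_objective_ge:
  assumes "s \<in> lower_solutions Y f x" "z \<in> Y"
  shows "F (x, s) - (\<sigma> + \<delta>) / 2 * (norm s)\<^sup>2 + \<sigma> / 2 * (norm (z - s))\<^sup>2
    \<le> smoothed_objective F f \<rho> \<sigma> \<delta> x s z"
proof -
  have "0 \<le> \<rho> * (f (x, z) - f (x, s))"
    using assms pos by (simp add: lower_solutions_def argmin_on_iff)
  moreover have "\<sigma> / 2 * (norm (z - s))\<^sup>2 =
      \<sigma> / 2 * (norm z)\<^sup>2 - \<sigma> * inner s z + \<sigma> / 2 * (norm s)\<^sup>2"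
    by (simp add: power2_norm_eq_inner inner_simps inner_commute field_simps)
  ultimately show ?thesis
    by (simp add: smoothed_objective_def algebra_simps add_divide_distrib)
qed

lemma inner_max_attained:
  assumes "z \<in> Y"
  obtains y where "y \<in> Y"
    "max_on (\<lambda>y. smoothed_objective F f \<rho> \<sigma> \<delta> x y z) Y = smoothed_objective F f \<rho> \<sigma> \<delta> x y z"
    "\<And>y'. y' \<in> Y \<Longrightarrow> smoothed_objective F f \<rho> \<sigma> \<delta> x y' z \<le> smoothed_objective F f \<rho> \<sigma> \<delta> x y z"
proof -
  obtain s where s: "s \<in> lower_solutions Y f x" using solvable by blast
  let ?\<psi> = "\<lambda>y. smoothed_objective F f \<rho> \<sigma> \<delta> x y z"
  \<comment> \<open>\<open>C\<close> arises from the upper bound on the objective after replacing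
    \<open>f (x, y)\<close> by its minimal value \<open>f (x, s)\<close>; it does not depend on
    \<open>y\<close>.\<close>
  define C where "C = \<rho> * (f (x, z) - f (x, s)) + (\<sigma> / 2 + \<sigma>\<^sup>2 / (2 * \<delta>)) * (norm z)\<^sup>2"
  have "compact {y\<in>Y. c \<le> ?\<psi> y}" for c
  proof (rule compact_superlevel_if_dominated[OF Y(1)])
    show "continuous_on Y ?\<psi>"
      unfolding smoothed_objective_def by (intro continuous_intros contF contf)
    show "bounded {y\<in>Y. c \<le> F (x, y) + C}"
      using bounded_superlevel[OF coercive, of "c - C"] by (simp add: algebra_simps)
    show "?\<psi> y \<le> F (x, y) + C" if "y \<in> Y" for y
    proof -
      have "\<rho> * f (x, s) \<le> \<rho> * f (x, y)"
        using s that pos by (simp add: lower_solutions_def argmin_on_iff)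
      then show ?thesis
        using smoothed_objective_le[of y z] by (simp add: C_def algebra_simps)
    qed
  qed
  from attains_max_of_compact_superlevels[OF Y(2) this]
  obtain y where "y \<in> Y" "\<And>y'. y' \<in> Y \<Longrightarrow> ?\<psi> y' \<le> ?\<psi> y" by blast
  then show ?thesis using that max_on_eqI[of y Y ?\<psi>] by blast
qed

lemma inner_max_le_iff:
  assumes "z \<in> Y"
  shows "max_on (\<lambda>y. smoothed_objective F f \<rho> \<sigma> \<delta> x y z) Y \<le> c \<longleftrightarrow>
    (\<forall>y\<in>Y. smoothed_objective F f \<rho> \<sigma> \<delta> x y z \<le> c)"
proof -
  obtain y where "y \<in> Y"
    "max_on (\<lambda>y. smoothed_objective F f \<rho> \<sigma> \<delta> x y z) Y = smoothed_objective F f \<rho> \<sigma> \<delta> x y z"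
    "\<And>y'. y' \<in> Y \<Longrightarrow> smoothed_objective F f \<rho> \<sigma> \<delta> x y' z \<le> smoothed_objective F f \<rho> \<sigma> \<delta> x y z"
    using inner_max_attained[OF assms] by blast
  then show ?thesis by force
qed

text \<open>A sublevel set of the inner maximum is an intersection over \<open>y\<close> of closed
  sets, and testing with \<open>y = s\<close> for a lower-level solution \<open>s\<close> bounds it.
  Attainment makes the \<open>LEAST\<close> behind \<open>min_on\<close> meaningful.\<close>

lemma smoothed_value_attained:
  obtains z where "z \<in> Y"
    "smoothed_value Y F f \<rho> \<sigma> \<delta> x = max_on (\<lambda>y. smoothed_objective F f \<rho> \<sigma> \<delta> x y z) Y"
    "\<And>z'. z' \<in> Y \<Longrightarrow>
      smoothed_value Y F f \<rho> \<sigma> \<delta> x \<le> max_on (\<lambda>y. smoothed_objective F f \<rho> \<sigma> \<delta> x y z') Y"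
proof -
  let ?h = "\<lambda>z. max_on (\<lambda>y. smoothed_objective F f \<rho> \<sigma> \<delta> x y z) Y"
  obtain s where s: "s \<in> lower_solutions Y f x" using solvable by blast
  then have sY: "s \<in> Y" by (simp add: lower_solutions_def argmin_on_iff)
  have "compact {z\<in>Y. ?h z \<le> c}" for c
  proof -
    have eq: "{z\<in>Y. ?h z \<le> c} = (\<Inter>y\<in>Y. {z\<in>Y. smoothed_objective F f \<rho> \<sigma> \<delta> x y z \<le> c})"
      using inner_max_le_iff Y(2) by auto
    have "closed {z\<in>Y. smoothed_objective F f \<rho> \<sigma> \<delta> x y z \<le> c}" for y
      unfolding smoothed_objective_def
      by (intro continuous_on_closed_Collect_le continuous_intros contf Y)
    then have "closed {z\<in>Y. ?h z \<le> c}" unfolding eq by blast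
    moreover have "bounded {z\<in>Y. ?h z \<le> c}"
    proof -
      \<comment> \<open>\<open>M\<close> is the bound on the squared distance to \<open>s\<close>
        obtained by solving the lower estimate for it.\<close>
      define M where "M = (c - F (x, s) + (\<sigma> + \<delta>) / 2 * (norm s)\<^sup>2) / (\<sigma> / 2)"
      have "dist s z \<le> sqrt M" if "z \<in> Y" "?h z \<le> c" for z
      proof -
        have "smoothed_objective F f \<rho> \<sigma> \<delta> x s z \<le> c"
          using that sY inner_max_le_iff by blast
        then have "\<sigma> / 2 * (norm (z - s))\<^sup>2 \<le> c - F (x, s) + (\<sigma> + \<delta>) / 2 * (norm s)\<^sup>2"
          using smoothed_objective_ge[OF s that(1)] by linarith
        then have "(norm (z - s))\<^sup>2 \<le> M"
          using pos by (simp add: M_def pos_le_divide_eq mult.commute)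
        then show ?thesis by (simp add: real_le_rsqrt dist_norm norm_minus_commute)
      qed
      then show ?thesis unfolding bounded_def by blast
    qed
    ultimately show ?thesis by (simp add: compact_eq_bounded_closed)
  qed
  from attains_min_of_compact_sublevels[OF Y(2) this]
  obtain z where z: "z \<in> Y" "\<And>z'. z' \<in> Y \<Longrightarrow> ?h z \<le> ?h z'" by blast
  then have "smoothed_value Y F f \<rho> \<sigma> \<delta> x = ?h z"
    unfolding smoothed_value_def by (intro min_on_eqI)
  with z that show ?thesis by simp
qed

text \<open>The competitor \<open>y = s\<close> is tested against the optimal \<open>z\<close>, and
  the square in \<open>z - s\<close> is dropped.\<close>

lemma smoothed_value_ge:
  assumes "s \<in> lower_solutions Y f x"
  shows "F (x, s) - (\<sigma> + \<delta>) / 2 * (norm s)\<^sup>2 \<le> smoothed_value Y F f \<rho> \<sigma> \<delta> x"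
proof -
  obtain z where z: "z \<in> Y"
    "smoothed_value Y F f \<rho> \<sigma> \<delta> x = max_on (\<lambda>y. smoothed_objective F f \<rho> \<sigma> \<delta> x y z) Y"
    using smoothed_value_attained by blast
  have "s \<in> Y" using assms by (simp add: lower_solutions_def argmin_on_iff)
  then have "smoothed_objective F f \<rho> \<sigma> \<delta> x s z \<le> smoothed_value Y F f \<rho> \<sigma> \<delta> x"
    using z inner_max_le_iff by auto
  moreover have "0 \<le> \<sigma> / 2 * (norm (z - s))\<^sup>2" using pos by simp
  ultimately show ?thesis using smoothed_objective_ge[OF assms z(1)] by linarith
qed

text \<open>The outer minimum is tested with \<open>z = s\<close>, turning the objective into a
  penalised \<open>F\<close> plus a small remainder.\<close>

lemma smoothed_value_le:
  assumes s: "s \<in> lower_solutions Y f x"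
    and bound: "\<And>y. y \<in> Y \<Longrightarrow> F (x, y) - \<rho> * (f (x, y) - f (x, s)) \<le> c"
  shows "smoothed_value Y F f \<rho> \<sigma> \<delta> x \<le> c + (\<sigma> / 2 + \<sigma>\<^sup>2 / (2 * \<delta>)) * (norm s)\<^sup>2"
proof -
  have sY: "s \<in> Y" using s by (simp add: lower_solutions_def argmin_on_iff)
  have "smoothed_value Y F f \<rho> \<sigma> \<delta> x \<le> max_on (\<lambda>y. smoothed_objective F f \<rho> \<sigma> \<delta> x y s) Y"
    using smoothed_value_attained sY by blast
  also have "\<dots> \<le> c + (\<sigma> / 2 + \<sigma>\<^sup>2 / (2 * \<delta>)) * (norm s)\<^sup>2"
    unfolding inner_max_le_iff[OF sY]
    using smoothed_objective_le bound by (meson add_right_mono order_trans)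
  finally show ?thesis .
qed

end

section \<open>Exactness of the penalty in the limit of large parameters\<close>

lemma eventually_penalty_le:
  fixes F g :: "'b::topological_space \<Rightarrow> real"
  assumes "compact K" "continuous_on K F" "continuous_on K g" "\<And>y. y \<in> K \<Longrightarrow> g y > 0"
  shows "\<forall>\<^sub>F r in at_top. \<forall>y\<in>K. F y - r * g y \<le> c"
proof (cases "K = {}")
  case False
  obtain a where a: "a \<in> K" "\<And>y. y \<in> K \<Longrightarrow> F y \<le> F a"
    using continuous_attains_sup[OF assms(1) False assms(2)] by blast
  obtain b where b: "b \<in> K" "\<And>y. y \<in> K \<Longrightarrow> g b \<le> g y"
    using continuous_attains_inf[OF assms(1) False assms(3)] by blast
  \<comment> \<open>The quotient compares the maximum of \<open>F\<close> with the minimum of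
    \<open>g\<close>; the \<open>max\<close> with 0 makes \<open>r\<close> nonnegative, so that
    multiplying by it preserves inequalities.\<close>
  have "\<forall>\<^sub>F r in at_top. max 0 ((F a - c) / g b) \<le> r" by (rule eventually_ge_at_top)
  then show ?thesis
  proof (eventually_elim, intro ballI)
    fix r y assume r: "max 0 ((F a - c) / g b) \<le> r" and y: "y \<in> K"
    have "F a - c \<le> r * g b" using r assms(4)[OF b(1)] by (simp add: pos_divide_le_eq)
    moreover have "r * g b \<le> r * g y" using r b(2)[OF y] by (simp add: mult_left_mono)
    ultimately show "F y - r * g y \<le> c" using a(2)[OF y] by linarith
  qed
qed simp

text \<open>No point of the compact set \<open>?K\<close> solves the lower level, since
  \<open>F\<close> on solutions is at most the pessimistic value; hence the penalty is positive
  there and eventually wins. Off \<open>?K\<close> the bound already holds for \<open>F\<close>, and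
  the penalty only lowers it.\<close>

lemma eventually_penalized_le_pessimistic_value:
  fixes F f :: "'a \<times> 'b::euclidean_space \<Rightarrow> real"
  assumes "closed Y" and contF: "continuous_on Y (\<lambda>y. F (x, y))"
    and contf: "continuous_on Y (\<lambda>y. f (x, y))"
    and "tends_to_minus_infinity_on Y (\<lambda>y. F (x, y))"
    and s: "s \<in> lower_solutions Y f x" and "e > 0"
  shows "\<forall>\<^sub>F r in at_top. \<forall>y\<in>Y.
    F (x, y) - r * (f (x, y) - f (x, s)) \<le> pessimistic_value Y F f x + e"
proof -
  let ?c = "pessimistic_value Y F f x + e"
  let ?K = "{y\<in>Y. ?c \<le> F (x, y)}"
  have "f (x, y) - f (x, s) > 0" if y: "y \<in> ?K" for y
  proof (rule ccontr)
    assume "\<not> ?thesis"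
    then have "y \<in> lower_solutions Y f x"
      using s y by (force simp: lower_solutions_def argmin_on_iff intro: order_trans)
    moreover have "lower_solutions Y f x \<noteq> {}" using s by blast
    then obtain y' where "pessimistic_value Y F f x = F (x, y')"
      "\<And>s. s \<in> lower_solutions Y f x \<Longrightarrow> F (x, s) \<le> F (x, y')"
      using pessimistic_value_attained[of Y F x f] assms by metis
    ultimately show False using y \<open>e > 0\<close> by fastforce
  qed
  then have "\<forall>\<^sub>F r in at_top. \<forall>y\<in>?K. F (x, y) - r * (f (x, y) - f (x, s)) \<le> ?c"
    using assms by (intro eventually_penalty_le compact_superlevel continuous_intros)
      (auto intro: continuous_on_subset)
  then show ?thesis
    using eventually_ge_at_top[of 0]
  proof (eventually_elim, intro ballI)
    fix r :: real and y
    assume K: "\<forall>y\<in>?K. F (x, y) - r * (f (x, y) - f (x, s)) \<le> ?c" and "0 \<le> r" and y: "y \<in> Y"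
    show "F (x, y) - r * (f (x, y) - f (x, s)) \<le> ?c"
    proof (cases "y \<in> ?K")
      case False
      moreover have "0 \<le> r * (f (x, y) - f (x, s))"
        using s y \<open>0 \<le> r\<close> by (simp add: lower_solutions_def argmin_on_iff)
      ultimately show ?thesis using y by auto
    qed (use K in blast)
  qed
qed

section \<open>Locally uniform coercivity and bounded pessimistic maximisers\<close>

text \<open>
  Concavity propagates the strict inequality on a sphere, where compactness makes it uniform
  in \<open>x\<close>, to everything outside the sphere.
\<close>

lemma locally_uniform_coercive:
  fixes F :: "'a::euclidean_space \<times> 'b::euclidean_space \<Rightarrow> real"
  assumes Y: "closed Y" "convex Y" and contF: "continuous_on UNIV F"
    and conc: "\<And>x. x \<in> X \<Longrightarrow> concave_on Y (\<lambda>y. F (x, y))"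
    and coercive: "tends_to_minus_infinity_on Y (\<lambda>y. F (xbar, y))"
    and y0: "y0 \<in> Y"
  obtains d R where "d > 0"
    "\<And>x y. x \<in> X \<Longrightarrow> dist x xbar < d \<Longrightarrow> y \<in> Y \<Longrightarrow> c \<le> F (x, y0) \<Longrightarrow> c \<le> F (x, y)
      \<Longrightarrow> dist y0 y < R"
proof -
  \<comment> \<open>The level \<open>c - 1\<close> leaves a slack of 1, to be spent when
    \<open>xbar\<close> is replaced by a nearby \<open>x\<close>.\<close>
  obtain R0 where R0: "\<And>y. y \<in> Y \<Longrightarrow> c - 1 \<le> F (xbar, y) \<Longrightarrow> dist y0 y \<le> R0"
    using bounded_superlevel[OF coercive, of "c - 1"] unfolding bounded_any_center[where a = y0]
    by blast
  define R where "R = max R0 0 + 1"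
  have R: "R > 0" "R > R0" by (auto simp: R_def)
  let ?T = "cball xbar 1 \<times> (Y \<inter> sphere y0 R)"
  have "uniformly_continuous_on ?T F"
    using Y by (intro compact_uniformly_continuous compact_Times continuous_on_subset[OF contF]
      closed_Int_compact) auto
  then obtain d where d: "d > 0" "\<And>p q. p \<in> ?T \<Longrightarrow> q \<in> ?T \<Longrightarrow> dist q p < d \<Longrightarrow> dist (F q) (F p) < 1"
    unfolding uniformly_continuous_on_def by (metis zero_less_one)
  show ?thesis
  proof (rule that)
    \<comment> \<open>The cap 1 keeps \<open>x\<close> in the ball on which uniform continuity was
      obtained.\<close>
    show "min d 1 > 0" using d by simp
    fix x y
    assume x: "x \<in> X" "dist x xbar < min d 1" and y: "y \<in> Y"
      and c: "c \<le> F (x, y0)" "c \<le> F (x, y)"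
    show "dist y0 y < R"
    proof (rule ccontr)
      assume far: "\<not> ?thesis"
      \<comment> \<open>With this \<open>t\<close>, \<open>w\<close> is the point where the segment
        from \<open>y0\<close> to \<open>y\<close> crosses the sphere of radius
        \<open>R\<close>.\<close>
      define t where "t = R / dist y0 y"
      have t: "0 \<le> t" "t \<le> 1" using far R by (auto simp: t_def divide_le_eq)
      define w where "w = (1 - t) *\<^sub>R y0 + t *\<^sub>R y"
      have wY: "w \<in> Y" unfolding w_def using t Y y y0 by (simp add: convexD_alt)
      have "y0 - w = t *\<^sub>R (y0 - y)" by (simp add: w_def algebra_simps)
      then have dw: "dist y0 w = R" using t far R by (auto simp: dist_norm t_def)
      have "F (x, w) \<ge> (1 - t) * F (x, y0) + t * F (x, y)"
        unfolding w_def using concave_onD[OF conc[OF x(1)] t y0 y] by simp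
      moreover have "(1 - t) * c + t * c \<le> (1 - t) * F (x, y0) + t * F (x, y)"
        using t c by (intro add_mono mult_left_mono) auto
      ultimately have "c \<le> F (x, w)" by (simp add: algebra_simps)
      moreover have "dist (F (x, w)) (F (xbar, w)) < 1"
        using x wY dw by (intro d(2)) (auto simp: dist_Pair_Pair dist_commute)
      ultimately have "c - 1 \<le> F (xbar, w)" by (simp add: dist_real_def)
      then show False using R0[OF wY] dw R by simp
    qed
  qed
qed

text \<open>The filter in \<open>lsc_on\<close> omits the point \<open>a\<close> itself; indices
  with \<open>u k = a\<close> are covered by \<open>c < g a\<close>.\<close>

lemma lsc_on_sequentially:
  assumes "lsc_on A g" "a \<in> A" "\<And>k. u k \<in> A" "u \<longlonglongrightarrow> a" "c < g a"
  shows "\<forall>\<^sub>F k in sequentially. c < g (u k)"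
proof -
  have "\<forall>\<^sub>F v in nhds a. v \<noteq> a \<longrightarrow> v \<in> A \<longrightarrow> c < g v"
    using assms(1,2,5) unfolding lsc_on_def eventually_at_filter by blast
  then have "\<forall>\<^sub>F k in sequentially. u k \<noteq> a \<longrightarrow> u k \<in> A \<longrightarrow> c < g (u k)"
    by (rule eventually_compose_filterlim[OF _ assms(4)])
  then show ?thesis by eventually_elim (use assms(3,5) in metis)
qed

lemma C1_lipschitz_gradient_on_imp_continuous:
  assumes "C1_lipschitz_gradient_on A g"
  shows "continuous_on UNIV g"
proof -
  obtain G where "\<And>p. GDERIV g p :> G p"
    using assms unfolding C1_lipschitz_gradient_on_def by blast
  then show ?thesis
    unfolding gderiv_def
    by (intro continuous_at_imp_continuous_on ballI) (rule has_derivative_continuous)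
qed

lemma continuous_on_section:
  assumes "continuous_on UNIV g"
  shows "continuous_on A (\<lambda>y. g (x, y))"
  by (rule continuous_on_compose2[OF assms]) (auto intro: continuous_on_Pair)

text \<open>Each \<open>u k\<close> has a lower-level solution in one bounded set, where
  \<open>F\<close> is bounded below uniformly in \<open>k\<close>. The maximal values inherit this
  bound, and locally uniform coercivity confines the \<open>y k\<close>.\<close>

lemma bounded_pessimistic_maximizers:
  fixes F f :: "'a::euclidean_space \<times> 'b::euclidean_space \<Rightarrow> real"
  assumes Y: "closed Y" "convex Y" and upper: "upper_level_assumptions X Y F"
    and lower: "lower_level_assumptions X Y f"
    and u: "\<And>k. u k \<in> X" "u \<longlonglongrightarrow> xbar" and "xbar \<in> X"
    and y: "\<And>k. y k \<in> Y"
    and y_max: "\<And>k s. s \<in> lower_solutions Y f (u k) \<Longrightarrow> F (u k, s) \<le> F (u k, y k)"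
  obtains B where "\<forall>\<^sub>F k in sequentially. norm (y k) \<le> B"
proof -
  have contF: "continuous_on UNIV F"
    using upper C1_lipschitz_gradient_on_imp_continuous by (auto simp: upper_level_assumptions_def)
  have bdu: "bounded (range u)" using u(2) convergent_imp_bounded by blast
  then obtain Dy where Dy: "bounded Dy" "Dy \<subseteq> Y"
    "\<And>k. lower_solutions Y f (u k) \<inter> Dy \<noteq> {}"
    using lower u(1) unfolding lower_level_assumptions_def by (metis image_subset_iff rangeI)
  have "compact (closure (range u \<times> Dy))"
    using bdu Dy(1) by (simp add: bounded_Times)
  then have "bounded (F ` closure (range u \<times> Dy))"
    by (intro compact_imp_bounded compact_continuous_image continuous_on_subset[OF contF]) auto
  then obtain M where M: "\<And>p. p \<in> closure (range u \<times> Dy) \<Longrightarrow> \<bar>F p\<bar> \<le> M"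
    unfolding bounded_iff by auto
  have low: "- M \<le> F (u k, s)" if "s \<in> Dy" for k s
    using M[of "(u k, s)"] that closure_subset[of "range u \<times> Dy"] by fastforce
  \<comment> \<open>Taking the centre in \<open>Dy\<close> gives \<open>F (u k, y0)\<close> the same
    lower bound \<open>- M\<close> as the maximal values.\<close>
  obtain y0 where y0: "y0 \<in> Dy" using Dy(3) by blast
  then have y0Y: "y0 \<in> Y" using Dy(2) by blast
  have conc: "\<And>x. x \<in> X \<Longrightarrow> concave_on Y (\<lambda>y. F (x, y))"
    and coerc: "tends_to_minus_infinity_on Y (\<lambda>y. F (xbar, y))"
    using upper \<open>xbar \<in> X\<close> by (auto simp: upper_level_assumptions_def)
  obtain d R where d: "d > 0" and R: "\<And>x y. x \<in> X \<Longrightarrow> dist x xbar < d \<Longrightarrow> y \<in> Y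
      \<Longrightarrow> - M \<le> F (x, y0) \<Longrightarrow> - M \<le> F (x, y) \<Longrightarrow> dist y0 y < R"
    using locally_uniform_coercive[OF Y contF conc coerc y0Y, where c = "- M"] by metis
  have "\<forall>\<^sub>F k in sequentially. dist (u k) xbar < d" using u(2) d by (rule tendstoD)
  then have "\<forall>\<^sub>F k in sequentially. norm (y k) \<le> norm y0 + R"
  proof eventually_elim
    case (elim k)
    obtain s where s: "s \<in> lower_solutions Y f (u k)" "s \<in> Dy" using Dy(3) by blast
    have "- M \<le> F (u k, y k)" using low[OF s(2), of k] y_max[OF s(1)] by linarith
    then have "dist y0 (y k) < R" using R u(1) elim y low[OF y0] by blast
    then show ?case using norm_triangle_ineq2[of "y k" y0] by (simp add: dist_norm norm_minus_commute)
  qed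
  then show ?thesis using that by blast
qed

section \<open>Comparison of limits along the convergent subsequence\<close>

theorem theorem2:
  fixes X :: "(real ^ 'n) set" and Y :: "(real ^ 'm) set"
    and F f :: "(real ^ 'n) \<times> (real ^ 'm) \<Rightarrow> real"
    and \<rho> \<sigma> \<delta> :: "nat \<Rightarrow> real"
    and x :: "nat \<Rightarrow> real ^ 'n" and xbar :: "real ^ 'n"
  assumes "X \<noteq> {}" "closed X" "convex X"
    and "Y \<noteq> {}" "closed Y" "convex Y"
    and "upper_level_assumptions X Y F"
    and "lower_level_assumptions X Y f"
    and "\<And>k. \<rho> k > 0" "\<And>k. \<sigma> k > 0" "\<And>k. \<delta> k > 0"
    and "filterlim \<rho> at_top sequentially"
    and "\<sigma> \<longlonglongrightarrow> 0" "\<delta> \<longlonglongrightarrow> 0"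
    and "limsup (\<lambda>k. ereal (\<sigma> k / \<delta> k)) < \<infinity>"
    and "lsc_on X (pessimistic_value Y F f)"
    and "\<And>k. x k \<in> argmin_on (smoothed_value Y F f (\<rho> k) (\<sigma> k) (\<delta> k)) X"
    and "\<exists>r :: nat \<Rightarrow> nat. strict_mono r \<and> (x \<circ> r) \<longlonglongrightarrow> xbar"
  shows "xbar \<in> argmin_on (pessimistic_value Y F f) X"
proof -
  let ?\<phi> = "pessimistic_value Y F f"
  let ?\<phi>s = "\<lambda>k. smoothed_value Y F f (\<rho> k) (\<sigma> k) (\<delta> k)"
  obtain r where r: "strict_mono r" and lim: "(x \<circ> r) \<longlonglongrightarrow> xbar" using assms(18) by blast
  define u where "u = x \<circ> r"
  have xX: "x k \<in> X" and x_min: "v \<in> X \<Longrightarrow> ?\<phi>s k (x k) \<le> ?\<phi>s k v" for k v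
    using assms(17) by (auto simp: argmin_on_iff)
  have u: "\<And>k. u k \<in> X" "u \<longlonglongrightarrow> xbar" using xX lim by (auto simp: u_def)
  have xbar: "xbar \<in> X" using closed_sequentially[OF assms(2)] u by blast
  have C1: "C1_lipschitz_gradient_on (X \<times> Y) F" "C1_lipschitz_gradient_on (X \<times> Y) f"
    using assms(7,8) by (simp_all add: upper_level_assumptions_def lower_level_assumptions_def)
  have contF: "continuous_on Y (\<lambda>y. F (v, y))" and contf: "continuous_on Y (\<lambda>y. f (v, y))" for v
    by (intro continuous_on_section C1_lipschitz_gradient_on_imp_continuous[OF C1(1)]
      C1_lipschitz_gradient_on_imp_continuous[OF C1(2)])+
  have coerc: "tends_to_minus_infinity_on Y (\<lambda>y. F (v, y))"
    and solvable: "lower_solutions Y f v \<noteq> {}" if "v \<in> X" for v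
    using assms(7,8) that unfolding upper_level_assumptions_def lower_level_assumptions_def by blast+

  have "\<exists>y\<in>lower_solutions Y f (u k). ?\<phi> (u k) = F (u k, y) \<and>
      (\<forall>s\<in>lower_solutions Y f (u k). F (u k, s) \<le> F (u k, y))" for k
    using pessimistic_value_attained[OF assms(5) contF contf coerc[OF u(1)] solvable[OF u(1)]]
    by metis
  then obtain y where y: "\<And>k. y k \<in> lower_solutions Y f (u k)" "\<And>k. ?\<phi> (u k) = F (u k, y k)"
    "\<And>k s. s \<in> lower_solutions Y f (u k) \<Longrightarrow> F (u k, s) \<le> F (u k, y k)"
    by metis
  have "y k \<in> Y" for k using y(1)[of k] by (simp add: lower_solutions_def argmin_on_iff)
  then obtain B where B: "\<forall>\<^sub>F k in sequentially. norm (y k) \<le> B"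
    using bounded_pessimistic_maximizers[OF assms(5,6,7,8) u xbar _ y(3)] by blast
  have lower: "?\<phi> (u k) - (\<sigma> (r k) + \<delta> (r k)) / 2 * (norm (y k))\<^sup>2 \<le> ?\<phi>s (r k) (u k)" for k
    unfolding y(2)
    by (rule smoothed_value_ge[OF assms(5,4) contF contf coerc[OF u(1)] solvable[OF u(1)]
      assms(9-11) y(1)])
  have lim_r: "(\<lambda>k. \<sigma> (r k)) \<longlonglongrightarrow> 0" "(\<lambda>k. \<delta> (r k)) \<longlonglongrightarrow> 0"
    using LIMSEQ_subseq_LIMSEQ[OF assms(13) r] LIMSEQ_subseq_LIMSEQ[OF assms(14) r]
    by (simp_all add: o_def)

  \<comment> \<open>The finite limsup makes the remainder of order \<sigma> squared over \<delta> a
    term of order \<sigma>.\<close>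
  obtain C where C: "\<forall>\<^sub>F k in sequentially. \<sigma> k / \<delta> k \<le> C"
  proof -
    obtain C where "limsup (\<lambda>k. ereal (\<sigma> k / \<delta> k)) < ereal C"
      using assms(15) less_PInf_Ex_of_nat by (metis ereal_dense2)
    from Limsup_lessD[OF this] have "\<forall>\<^sub>F k in sequentially. \<sigma> k / \<delta> k \<le> C"
      by eventually_elim simp
    then show ?thesis using that by blast
  qed

  have "?\<phi> xbar \<le> ?\<phi> v" if v: "v \<in> X" for v
  proof (rule field_le_epsilon)
    fix e :: real assume "e > 0"
    obtain s where s: "s \<in> lower_solutions Y f v" using solvable[OF v] by blast
    \<comment> \<open>The error \<open>e\<close> is split into quarters: penalty, upper remainder,
      lower remainder, and lower semicontinuity.\<close>
    have "\<forall>\<^sub>F k in sequentially. \<forall>y\<in>Y. F (v, y) - \<rho> k * (f (v, y) - f (v, s)) \<le> ?\<phi> v + e / 4"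
      by (rule eventually_compose_filterlim[OF _ assms(12)],
          rule eventually_penalized_le_pessimistic_value[OF assms(5) contF contf coerc[OF v] s])
        (use \<open>e > 0\<close> in simp)
    \<comment> \<open>The factor \<open>(1 + C) / 2\<close> comes from pulling
      \<open>\<sigma> k\<close> out of
      \<open>\<sigma> k / 2 + (\<sigma> k)\<^sup>2 / (2 * \<delta> k)\<close>.\<close>
    moreover have "\<forall>\<^sub>F k in sequentially. \<sigma> k * ((1 + C) / 2 * (norm s)\<^sup>2) < e / 4"
      by (rule order_tendstoD(2)[OF tendsto_mult_left_zero[OF assms(13)]]) (use \<open>e > 0\<close> in simp)
    ultimately have "\<forall>\<^sub>F k in sequentially. ?\<phi>s k v \<le> ?\<phi> v + e / 2"
      using C
    proof eventually_elim
      case (elim k)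
      have "?\<phi>s k v \<le> ?\<phi> v + e / 4 + (\<sigma> k / 2 + (\<sigma> k)\<^sup>2 / (2 * \<delta> k)) * (norm s)\<^sup>2"
        by (rule smoothed_value_le[OF assms(5,4) contF contf coerc[OF v] solvable[OF v]
          assms(9-11) s]) (use elim(1) in blast)
      also have "\<sigma> k / 2 + (\<sigma> k)\<^sup>2 / (2 * \<delta> k) = \<sigma> k * ((1 + \<sigma> k / \<delta> k) / 2)"
        by (simp add: power2_eq_square field_simps)
      also have "\<dots> \<le> \<sigma> k * ((1 + C) / 2)"
        using assms(10)[of k] elim(3)
        by (intro mult_left_mono divide_right_mono add_left_mono) simp_all
      finally show ?case using elim(2) by (simp add: mult_right_mono mult.assoc)
    qed
    then have up: "\<forall>\<^sub>F k in sequentially. ?\<phi>s (r k) v \<le> ?\<phi> v + e / 2"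
      by (rule eventually_subseq[OF r])
    have "(\<lambda>k. (\<sigma> (r k) + \<delta> (r k)) / 2 * B\<^sup>2) \<longlonglongrightarrow> 0"
      by (auto intro!: tendsto_eq_intros lim_r)
    then have "\<forall>\<^sub>F k in sequentially. (\<sigma> (r k) + \<delta> (r k)) / 2 * B\<^sup>2 < e / 4"
      by (rule order_tendstoD(2)) (use \<open>e > 0\<close> in simp)
    moreover have "\<forall>\<^sub>F k in sequentially. ?\<phi> xbar - e / 4 < ?\<phi> (u k)"
      using lsc_on_sequentially[OF assms(16) xbar u] \<open>e > 0\<close> by simp
    \<comment> \<open>The chain runs from \<open>xbar\<close> to \<open>u k\<close> by
      semicontinuity, to the smoothed value at \<open>u k\<close> by the lower estimate, to that at
      \<open>v\<close> by minimality, and to \<open>?\<phi> v\<close> by the upper estimate.\<close>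
    ultimately have "\<forall>\<^sub>F k in sequentially. ?\<phi> xbar \<le> ?\<phi> v + e"
      using B up
    proof eventually_elim
      case (elim k)
      have "(\<sigma> (r k) + \<delta> (r k)) / 2 * (norm (y k))\<^sup>2 \<le> (\<sigma> (r k) + \<delta> (r k)) / 2 * B\<^sup>2"
        using elim(3) assms(10,11)[of "r k"] by (intro mult_left_mono power_mono) auto
      moreover have "?\<phi>s (r k) (u k) \<le> ?\<phi>s (r k) v" using x_min[OF v] by (simp add: u_def)
      ultimately show ?case using lower[of k] elim by linarith
    qed
    then show "?\<phi> xbar \<le> ?\<phi> v + e" by simp
  qed
  with xbar show ?thesis by (simp add: argmin_on_iff)
qed

end
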